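(* Let $G=(V,E)$ be an undirected graph with edge capacities $c\in\mathbb{R}_{>0}^{E}$, let $s,t\in V$ be distinct vertices, let $\alpha\ge1$, and let $(S,T)$ be an $\alpha$-fair $(s,t)$-cut of $G$. Then for any distinct $u,v\in S$ there exists $R\subset S$ such that $(R,V\setminus R)$ is an $\alpha$-approximate $(u,v)$-mincut, i.e., $R$ contains exactly one of $u,v$ and the total capacity of the edges between $R$ and $V\setminus R$ is at most $\alpha$ times the minimum capacity of a cut separating $u$ from $v$ in $G$.
   Context: A flow is a function $f:V\times V\to\mathbb{R}$ with $f(u,v)=-f(v,u)$ and $f(u,v)=0$ whenever $\{u,v\}\notin E$; it is feasible if $|f(u,v)|\le c(u,v)$ for every edge. The net flow out of $v$ is $f(v)=\sum_{u}f(v,u)$. An $(s,t)$-flow is a flow with $f(v)=0$ for all $v\ne s,t$. An $(s,t)$-cut is a partition $(S,T)$ of $V$ with $s\in S$, $t\in T$; $E(S,T)$ is the set of edges between $S$ and $T$. For $\alpha\ge 1$, an $(s,t)$-cut $(S,T)$ is an $\alpha$-fair $(s,t)$-cut if there exists a feasible $(s,t)$-flow $f$ such that $f(u,v)\ge\frac1\alpha c(u,v)$ for every edge $(u,v)\in E(S,T)$ with $u\in S$, $v\in T$. *)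

theory Defs
  imports Complex_Main
begin

text \<open>Edges are two-element vertex sets, so the capacity written $c(u,v)$ is \<open>c {u, v}\<close>.\<close>

definition capacitated_graph :: "'a set \<Rightarrow> 'a set set \<Rightarrow> ('a set \<Rightarrow> real) \<Rightarrow> bool" where
  "capacitated_graph V E c \<longleftrightarrow>
     finite V \<and> (\<forall>e\<in>E. e \<subseteq> V \<and> card e = 2) \<and> (\<forall>e\<in>E. 0 < c e)"

text \<open>A flow is a function on \<open>V \<times> V\<close>; values of \<open>f\<close> outside \<open>V\<close> are unconstrained and never used.\<close>

definition is_flow :: "'a set \<Rightarrow> 'a set set \<Rightarrow> ('a \<Rightarrow> 'a \<Rightarrow> real) \<Rightarrow> bool" where
  "is_flow V E f \<longleftrightarrow>
     (\<forall>u\<in>V. \<forall>v\<in>V. f u v = - f v u) \<and>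
     (\<forall>u\<in>V. \<forall>v\<in>V. {u, v} \<notin> E \<longrightarrow> f u v = 0)"

definition feasible :: "'a set \<Rightarrow> 'a set set \<Rightarrow> ('a set \<Rightarrow> real) \<Rightarrow> ('a \<Rightarrow> 'a \<Rightarrow> real) \<Rightarrow> bool" where
  "feasible V E c f \<longleftrightarrow>
     (\<forall>u\<in>V. \<forall>v\<in>V. {u, v} \<in> E \<longrightarrow> \<bar>f u v\<bar> \<le> c {u, v})"

definition net_flow :: "'a set \<Rightarrow> ('a \<Rightarrow> 'a \<Rightarrow> real) \<Rightarrow> 'a \<Rightarrow> real" where
  "net_flow V f v = (\<Sum>u\<in>V. f v u)"

definition is_st_flow :: "'a set \<Rightarrow> 'a set set \<Rightarrow> 'a \<Rightarrow> 'a \<Rightarrow> ('a \<Rightarrow> 'a \<Rightarrow> real) \<Rightarrow> bool" where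
  "is_st_flow V E s t f \<longleftrightarrow>
     is_flow V E f \<and> (\<forall>v\<in>V. v \<noteq> s \<and> v \<noteq> t \<longrightarrow> net_flow V f v = 0)"

definition is_st_cut :: "'a set \<Rightarrow> 'a \<Rightarrow> 'a \<Rightarrow> 'a set \<Rightarrow> 'a set \<Rightarrow> bool" where
  "is_st_cut V s t S T \<longleftrightarrow> S \<union> T = V \<and> S \<inter> T = {} \<and> s \<in> S \<and> t \<in> T"

definition edges_between :: "'a set set \<Rightarrow> 'a set \<Rightarrow> 'a set \<Rightarrow> 'a set set" where
  "edges_between E S T = {e \<in> E. \<exists>u\<in>S. \<exists>v\<in>T. e = {u, v}}"

definition is_fair_cut ::
  "real \<Rightarrow> 'a set \<Rightarrow> 'a set set \<Rightarrow> ('a set \<Rightarrow> real) \<Rightarrow> 'a \<Rightarrow> 'a \<Rightarrow> 'a set \<Rightarrow> 'a set \<Rightarrow> bool" where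
  "is_fair_cut \<alpha> V E c s t S T \<longleftrightarrow>
     is_st_cut V s t S T \<and>
     (\<exists>f. is_st_flow V E s t f \<and> feasible V E c f \<and>
          (\<forall>u\<in>S. \<forall>v\<in>T. {u, v} \<in> edges_between E S T \<longrightarrow> f u v \<ge> 1 / \<alpha> * c {u, v}))"

definition cut_capacity :: "'a set \<Rightarrow> 'a set set \<Rightarrow> ('a set \<Rightarrow> real) \<Rightarrow> 'a set \<Rightarrow> real" where
  "cut_capacity V E c R = sum c (edges_between E R (V - R))"

definition separates :: "'a set \<Rightarrow> 'a \<Rightarrow> 'a \<Rightarrow> bool" where
  "separates R u v \<longleftrightarrow> (u \<in> R \<and> v \<notin> R) \<or> (u \<notin> R \<and> v \<in> R)"

text \<open>For finite \<open>V\<close> and distinct \<open>u, v \<in> V\<close> the set below is finite and nonempty, so the minimum is attained.\<close>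

definition mincut_value ::
  "'a set \<Rightarrow> 'a set set \<Rightarrow> ('a set \<Rightarrow> real) \<Rightarrow> 'a \<Rightarrow> 'a \<Rightarrow> real" where
  "mincut_value V E c u v = Min {cut_capacity V E c R | R. R \<subseteq> V \<and> separates R u v}"

definition is_approx_mincut ::
  "real \<Rightarrow> 'a set \<Rightarrow> 'a set set \<Rightarrow> ('a set \<Rightarrow> real) \<Rightarrow> 'a \<Rightarrow> 'a \<Rightarrow> 'a set \<Rightarrow> bool" where
  "is_approx_mincut \<alpha> V E c u v R \<longleftrightarrow>
     R \<subseteq> V \<and> separates R u v \<and> cut_capacity V E c R \<le> \<alpha> * mincut_value V E c u v"

end

theory Submission
  imports Defs
begin

text \<open>
  Let \<open>W\<close> be a minimum \<open>(u, v)\<close>-cut, complemented if necessary so that \<open>t \<notin> W\<close>, and take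
  \<open>R = W \<inter> S\<close>. Compared with \<open>W\<close>, the cut \<open>R\<close> gains only the edges between \<open>W \<inter> S\<close> and \<open>W \<inter> T\<close>.
  Fairness saturates them up to a factor \<open>\<alpha>\<close> with flow into \<open>W \<inter> T\<close>. This set contains neither
  \<open>s\<close> nor \<open>t\<close>, so the flow has to leave it again; it cannot leave towards \<open>S - W\<close>, where the flow
  also runs from \<open>S\<close> to \<open>T\<close>, and hence is bounded by the capacity between \<open>W \<inter> T\<close> and \<open>T - W\<close>.
  Those edges are cut by \<open>W\<close> but not by \<open>R\<close>.
\<close>

text \<open>Extending \<open>c\<close> by zero to all ordered pairs turns capacities of edge sets
  into double sums over vertex blocks, which can be split and compared termwise with flows.\<close>

definition edge_weight :: "'a set set \<Rightarrow> ('a set \<Rightarrow> real) \<Rightarrow> 'a \<Rightarrow> 'a \<Rightarrow> real" where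
  "edge_weight E c x y = (if {x, y} \<in> E then c {x, y} else 0)"

definition block_sum :: "('a \<Rightarrow> 'a \<Rightarrow> real) \<Rightarrow> 'a set \<Rightarrow> 'a set \<Rightarrow> real" where
  "block_sum g A B = (\<Sum>x\<in>A. \<Sum>y\<in>B. g x y)"

lemma block_sum_union_left:
  "finite A \<Longrightarrow> finite A' \<Longrightarrow> A \<inter> A' = {} \<Longrightarrow>
    block_sum g (A \<union> A') B = block_sum g A B + block_sum g A' B"
  by (simp add: block_sum_def sum.union_disjoint)

lemma block_sum_union_right:
  "finite B \<Longrightarrow> finite B' \<Longrightarrow> B \<inter> B' = {} \<Longrightarrow>
    block_sum g A (B \<union> B') = block_sum g A B + block_sum g A B'"
  by (simp add: block_sum_def sum.union_disjoint sum.distrib)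

lemma block_sum_mono:
  "(\<And>x y. x \<in> A \<Longrightarrow> y \<in> B \<Longrightarrow> g x y \<le> h x y) \<Longrightarrow> block_sum g A B \<le> block_sum h A B"
  by (simp add: block_sum_def sum_mono)

lemma block_sum_antisym:
  assumes "\<And>x y. x \<in> A \<Longrightarrow> y \<in> B \<Longrightarrow> g x y = - g y x"
  shows "block_sum g A B = - block_sum g B A"
proof -
  have "block_sum g A B = (\<Sum>x\<in>A. \<Sum>y\<in>B. - g y x)"
    unfolding block_sum_def using assms by (intro sum.cong) auto
  also have "\<dots> = - block_sum g B A"
    unfolding block_sum_def by (subst sum.swap) (simp add: sum_negf)
  finally show ?thesis .
qed

text \<open>Since \<open>A\<close> and \<open>B\<close> are disjoint, each edge between them comes
  from exactly one ordered pair in \<open>A \<times> B\<close>; all other pairs have weight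
  0.\<close>

lemma sum_edges_between:
  assumes "finite A" "finite B" "A \<inter> B = {}"
  shows "sum c (edges_between E A B) = block_sum (edge_weight E c) A B"
proof -
  let ?P = "{(x, y). x \<in> A \<and> y \<in> B \<and> {x, y} \<in> E}"
  have "inj_on (\<lambda>(x, y). {x, y}) ?P"
    using assms(3) by (auto simp: inj_on_def doubleton_eq_iff)
  moreover have "edges_between E A B = (\<lambda>(x, y). {x, y}) ` ?P"
    by (auto simp: edges_between_def image_def)
  ultimately have "sum c (edges_between E A B) = (\<Sum>(x, y)\<in>?P. c {x, y})"
    by (simp add: sum.reindex case_prod_unfold comp_def)
  also have "\<dots> = (\<Sum>(x, y)\<in>A \<times> B. edge_weight E c x y)"
    using assms by (intro sum.mono_neutral_cong_left) (auto simp: edge_weight_def)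
  also have "\<dots> = block_sum (edge_weight E c) A B"
    by (simp add: block_sum_def sum.cartesian_product)
  finally show ?thesis .
qed

lemma cut_capacity_eq_block_sum:
  assumes "finite V" "R \<subseteq> V"
  shows "cut_capacity V E c R = block_sum (edge_weight E c) R (V - R)"
  unfolding cut_capacity_def using assms by (intro sum_edges_between) (auto intro: finite_subset)

lemma cut_capacity_complement:
  assumes "R \<subseteq> V"
  shows "cut_capacity V E c (V - R) = cut_capacity V E c R"
proof -
  have "edges_between E (V - R) R = edges_between E R (V - R)"
    unfolding edges_between_def by (metis insert_commute)
  then show ?thesis
    using assms by (simp add: cut_capacity_def double_diff)
qed

text \<open>There are finitely many candidate sets, and \<open>{u}\<close> is one of them.\<close>

lemma mincut_attained:
  assumes "finite V" "u \<in> V" "u \<noteq> v"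
  obtains W where "W \<subseteq> V" "separates W u v" "cut_capacity V E c W = mincut_value V E c u v"
proof -
  let ?C = "{cut_capacity V E c R | R. R \<subseteq> V \<and> separates R u v}"
  have "?C \<subseteq> cut_capacity V E c ` Pow V"
    by auto
  then have "finite ?C"
    using assms(1) by (meson finite_Pow_iff finite_imageI finite_subset)
  moreover have "{u} \<subseteq> V \<and> separates {u} u v"
    using assms by (auto simp: separates_def)
  then have "?C \<noteq> {}"
    by blast
  ultimately have "mincut_value V E c u v \<in> ?C"
    unfolding mincut_value_def by (rule Min_in)
  then show ?thesis
    using that by auto
qed

text \<open>Summing conservation over \<open>A\<close> gives total flow 0 from \<open>A\<close> to
  \<open>V\<close>, and the part inside \<open>A\<close> cancels by antisymmetry.\<close>

lemma net_flow_across_eq_0: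
  assumes "finite V" "is_st_flow V E s t f" "A \<subseteq> V" "s \<notin> A" "t \<notin> A"
  shows "block_sum f A (V - A) = 0"
proof -
  have anti: "f x y = - f y x" if "x \<in> A" "y \<in> A" for x y
    using assms(2,3) that unfolding is_st_flow_def is_flow_def by blast
  have "net_flow V f x = 0" if "x \<in> A" for x
  proof -
    have "x \<in> V" "x \<noteq> s" "x \<noteq> t"
      using assms(3-5) that by auto
    then show ?thesis
      using assms(2) by (simp add: is_st_flow_def)
  qed
  then have "block_sum f A V = 0"
    by (simp add: block_sum_def net_flow_def)
  \<comment> \<open>Exchanging the two equal blocks shows that this sum is its own negative.\<close>
  moreover have "block_sum f A A = 0"
    using block_sum_antisym[of A A f, OF anti] by linarith
  moreover have "block_sum f A V = block_sum f A A + block_sum f A (V - A)"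
    using assms(1,3) block_sum_union_right[of A "V - A" f A]
    by (simp add: finite_subset Un_absorb1)
  ultimately show ?thesis
    by simp
qed

text \<open>The uncrossing bound holds for every \<open>W\<close> that avoids \<open>t\<close>,
  minimum or not; the source may lie on either side of \<open>W\<close>.\<close>

lemma fair_cut_uncross:
  assumes graph: "capacitated_graph V E c"
    and \<alpha>: "\<alpha> \<ge> 1"
    and fair: "is_fair_cut \<alpha> V E c s t S T"
    and W: "W \<subseteq> V" "t \<notin> W"
  shows "cut_capacity V E c (W \<inter> S) \<le> \<alpha> * cut_capacity V E c W"
proof -
  have cut: "S \<union> T = V" "S \<inter> T = {}" "s \<in> S"
    using fair by (auto simp: is_fair_cut_def is_st_cut_def)
  obtain f where st_flow: "is_st_flow V E s t f" and feas: "feasible V E c f"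
    and sat: "\<And>x y. x \<in> S \<Longrightarrow> y \<in> T \<Longrightarrow> {x, y} \<in> edges_between E S T \<Longrightarrow> f x y \<ge> 1 / \<alpha> * c {x, y}"
    using fair unfolding is_fair_cut_def by blast
  have anti: "f x y = - f y x" and no_edge: "{x, y} \<notin> E \<Longrightarrow> f x y = 0"
    if "x \<in> V" "y \<in> V" for x y
    using st_flow that unfolding is_st_flow_def is_flow_def by blast+
  have finV: "finite V" and pos: "\<And>e. e \<in> E \<Longrightarrow> 0 < c e"
    using graph by (auto simp: capacitated_graph_def)
  define w where "w = edge_weight E c"
  \<comment> \<open>The two cuts cross in four blocks: \<open>S\<close> is \<open>A\<close> with
    \<open>B\<close>, \<open>T\<close> is \<open>C\<close> with \<open>D\<close>, and
    \<open>W\<close> is \<open>A\<close> with \<open>C\<close>.\<close>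
  define A B C D where "A = W \<inter> S" and "B = S - W" and "C = W \<inter> T" and "D = T - W"
  note defs = A_def B_def C_def D_def
  have sub: "A \<subseteq> S" "B \<subseteq> S" "C \<subseteq> T" "D \<subseteq> T" "S \<subseteq> V" "T \<subseteq> V"
    using cut by (auto simp: defs)
  have fin: "finite A" "finite B" "finite C" "finite D"
    using finV sub by (meson finite_subset)+
  have w_nonneg: "0 \<le> w x y" for x y
    by (simp add: w_def edge_weight_def pos less_imp_le)
  \<comment> \<open>Fairness extends to all pairs across the cut, because on non-edges both sides
    are 0.\<close>
  have fair_edge: "w x y \<le> \<alpha> * f x y" if "x \<in> S" "y \<in> T" for x y
  proof (cases "{x, y} \<in> E")
    case True
    then have "{x, y} \<in> edges_between E S T"
      using that unfolding edges_between_def by blast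
    then show ?thesis
      using sat[OF that] \<alpha> True by (simp add: w_def edge_weight_def field_simps)
  next
    case False
    moreover have "f x y = 0"
      using no_edge False that sub by blast
    ultimately show ?thesis
      by (simp add: w_def edge_weight_def)
  qed
  have flow_nonneg: "0 \<le> f x y" if "x \<in> S" "y \<in> T" for x y
    using order_trans[OF w_nonneg fair_edge[OF that]] \<alpha> by (simp add: zero_le_mult_iff)
  have flow_le: "f x y \<le> w x y" if "x \<in> V" "y \<in> V" for x y
    using feas no_edge that unfolding feasible_def w_def edge_weight_def by fastforce
  have "V - C = A \<union> (B \<union> D)"
    using cut W by (auto simp: defs)
  \<comment> \<open>Conservation applies on \<open>C\<close>: \<open>s\<close> lies in
    \<open>S\<close>, hence outside \<open>T\<close>, and \<open>t\<close> lies outside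
    \<open>W\<close>.\<close>
  moreover have "block_sum f C (V - C) = 0"
    using cut W by (intro net_flow_across_eq_0[OF finV st_flow]) (auto simp: C_def)
  moreover have "A \<inter> (B \<union> D) = {}" "B \<inter> D = {}"
    using cut by (auto simp: defs)
  ultimately have "block_sum f C A + (block_sum f C B + block_sum f C D) = 0"
    using fin by (simp add: block_sum_union_right)
  moreover have "block_sum f C A = - block_sum f A C" "block_sum f C B = - block_sum f B C"
    by (rule block_sum_antisym, rule anti; use sub in blast)+
  moreover have "0 \<le> block_sum f B C"
    unfolding block_sum_def using flow_nonneg sub by (intro sum_nonneg) blast
  moreover have "block_sum f C D \<le> block_sum w C D"
    using sub by (intro block_sum_mono flow_le) auto
  ultimately have "block_sum f A C \<le> block_sum w C D"
    by simp
  moreover have "block_sum w A C \<le> block_sum (\<lambda>x y. \<alpha> * f x y) A C"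
    using sub by (intro block_sum_mono fair_edge) auto
  then have "block_sum w A C \<le> \<alpha> * block_sum f A C"
    by (simp add: block_sum_def sum_distrib_left)
  \<comment> \<open>What \<open>A\<close> cuts in addition to \<open>W\<close> is paid for, up to
    the factor \<open>\<alpha>\<close>, by the edges between \<open>C\<close> and
    \<open>D\<close>.\<close>
  ultimately have gain: "block_sum w A C \<le> \<alpha> * block_sum w C D"
    using \<alpha> mult_left_mono[of "block_sum f A C" "block_sum w C D" \<alpha>] by linarith
  have W_eq: "W = A \<union> C"
    using cut W by (auto simp: defs)
  have "cut_capacity V E c A = block_sum w A (C \<union> (B \<union> D))"
  proof -
    have "V - A = C \<union> (B \<union> D)" "A \<subseteq> V"
      using cut W by (auto simp: defs)
    then show ?thesis
      using cut_capacity_eq_block_sum[OF finV, of A] by (simp add: w_def)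
  qed
  moreover have "C \<inter> (B \<union> D) = {}"
    using cut by (auto simp: defs)
  ultimately have capA: "cut_capacity V E c A = block_sum w A C + block_sum w A (B \<union> D)"
    using fin by (simp add: block_sum_union_right)
  have "cut_capacity V E c W = block_sum w (A \<union> C) (B \<union> D)"
  proof -
    have "V - W = B \<union> D"
      using cut W by (auto simp: defs)
    then show ?thesis
      using cut_capacity_eq_block_sum[OF finV W(1)] by (simp add: w_def flip: W_eq)
  qed
  moreover have "B \<inter> D = {}" "A \<inter> C = {}"
    using cut by (auto simp: defs)
  ultimately have capW: "cut_capacity V E c W =
      block_sum w A (B \<union> D) + (block_sum w C B + block_sum w C D)"
    using fin by (simp add: block_sum_union_left block_sum_union_right[of B D w C])
  have nonneg: "0 \<le> block_sum w X Y" for X Y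
    by (simp add: block_sum_def w_nonneg sum_nonneg)
  \<comment> \<open>The edges from \<open>A\<close> to \<open>B \<union> D\<close> are cut by both
    sets, so \<open>\<alpha> \<ge> 1\<close> suffices for them; those between \<open>C\<close> and
    \<open>B\<close> only enlarge the right-hand side.\<close>
  have "block_sum w A (B \<union> D) \<le> \<alpha> * block_sum w A (B \<union> D)" "0 \<le> \<alpha> * block_sum w C B"
    using \<alpha> nonneg[of A "B \<union> D"] nonneg[of C B] by (simp_all add: mult_le_cancel_right1)
  then have "cut_capacity V E c A \<le> \<alpha> * cut_capacity V E c W"
    unfolding capA capW distrib_left using gain by linarith
  then show ?thesis
    by (simp add: A_def)
qed

theorem lemma1p2:
  fixes V S T :: "'a set" and E :: "'a set set" and c :: "'a set \<Rightarrow> real"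
    and s t :: 'a and \<alpha> :: real
  assumes "capacitated_graph V E c"
    and "s \<in> V" and "t \<in> V" and "s \<noteq> t"
    and "\<alpha> \<ge> 1"
    and "is_fair_cut \<alpha> V E c s t S T"
  shows "\<forall>u\<in>S. \<forall>v\<in>S. u \<noteq> v \<longrightarrow> (\<exists>R. R \<subset> S \<and> is_approx_mincut \<alpha> V E c u v R)"
proof (intro ballI impI)
  fix u v assume uv: "u \<in> S" "v \<in> S" "u \<noteq> v"
  have "S \<subseteq> V"
    using assms(6) by (auto simp: is_fair_cut_def is_st_cut_def)
  moreover have "finite V"
    using assms(1) by (simp add: capacitated_graph_def)
  ultimately obtain W' where W': "W' \<subseteq> V" "separates W' u v"
      "cut_capacity V E c W' = mincut_value V E c u v"
    using mincut_attained uv by (metis subsetD)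
  \<comment> \<open>Complementing changes neither the capacity nor the separation of
    \<open>u\<close> from \<open>v\<close>.\<close>
  define W where "W = (if t \<in> W' then V - W' else W')"
  have W: "W \<subseteq> V" "t \<notin> W" "separates W u v" "cut_capacity V E c W = mincut_value V E c u v"
    using W' uv \<open>S \<subseteq> V\<close> by (auto simp: W_def cut_capacity_complement separates_def)
  have "separates (W \<inter> S) u v"
    using W(3) uv by (auto simp: separates_def)
  \<comment> \<open>Strict because \<open>S\<close> contains both \<open>u\<close> and
    \<open>v\<close>, while a separating set misses one of them.\<close>
  moreover have "W \<inter> S \<subset> S"
    using calculation uv by (auto simp: separates_def)
  moreover have "cut_capacity V E c (W \<inter> S) \<le> \<alpha> * mincut_value V E c u v"
    using fair_cut_uncross[OF assms(1,5,6) W(1,2)] W(4) by simp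
  ultimately show "\<exists>R. R \<subset> S \<and> is_approx_mincut \<alpha> V E c u v R"
    using \<open>S \<subseteq> V\<close> by (auto simp: is_approx_mincut_def)
qed

end
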